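(* Let $G$ be the complement of the Mycielski--Grötzsch graph, i.e. the graph on the vertices $x_1,\ldots,x_{11}$ with edge ideal $$\begin{aligned}I(G)=(&x_1x_3,x_1x_4,x_2x_4,x_2x_5,x_3x_5,x_1x_6,x_1x_8,x_1x_9,x_2x_7,x_2x_9,x_2x_{10},x_3x_6,x_3x_8,x_3x_{10},\\&x_4x_6,x_4x_7,x_4x_9,x_5x_7,x_5x_8,x_5x_{10},x_1x_{11},x_2x_{11},x_3x_{11},x_4x_{11},x_5x_{11},\\&x_6x_7,x_6x_8,x_6x_9,x_6x_{10},x_7x_8,x_7x_9,x_7x_{10},x_8x_9,x_8x_{10},x_9x_{10}).\end{aligned}$$ Then, for every field $K$, with $S=K[x_1,\ldots,x_{11}]$, the ring $S/I(G)$ has no 0-1 linear system of parameters.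
   Context: The edge ideal of a graph $G$ is generated by the monomials $x_ix_j$ with $\{x_i,x_j\}\in E(G)$. The Mycielski--Grötzsch graph here has vertices $x_1,\ldots,x_{11}$ and edges $x_1x_2,x_2x_3,x_3x_4,x_1x_5,x_4x_5,x_2x_6,x_5x_6,x_1x_7,x_3x_7,x_2x_8,x_4x_8,x_3x_9,x_5x_9,x_1x_{10},x_4x_{10},x_6x_{11},x_7x_{11},x_8x_{11},x_9x_{11},x_{10}x_{11}$. With $\mathfrak m=(x_1,\ldots,x_{11})$, linear forms $f_1,\ldots,f_d\in S$ form a linear system of parameters for $S/I(G)$ if $d=\dim(S/I(G))$ and $\mathrm{rad}(I(G),f_1,\ldots,f_d)=\mathfrak m$; it is a 0-1 linear system of parameters if all coefficients of the $f_i$ lie in $\{0,1\}\subset K$. *)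

theory Defs
  imports
    "HOL-Algebra.Algebraic_Closure_Type"
    "HOL-Library.Poly_Mapping"
    "HOL-Library.Numeral_Type"
    "HOL-Library.Extended_Nat"
begin

section \<open>Polynomial rings in finitely many variables\<close>

text \<open>
  The polynomial ring over \<open>'k\<close> in variables indexed by \<open>'v\<close>: a polynomial maps each exponent
  vector in \<open>'v \<Rightarrow>\<^sub>0 nat\<close> to its coefficient.
\<close>

type_synonym ('v, 'k) mpoly = "('v \<Rightarrow>\<^sub>0 nat) \<Rightarrow>\<^sub>0 'k"

abbreviation mpoly_ring :: "('v, 'k::field) mpoly ring" where
  "mpoly_ring \<equiv> ring_of_type_algebra"

definition var :: "'v \<Rightarrow> ('v, 'k::field) mpoly" where
  "var i = Poly_Mapping.single (Poly_Mapping.single i 1) 1"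

definition maximal_homogeneous_ideal :: "('v, 'k::field) mpoly set" where
  "maximal_homogeneous_ideal = genideal mpoly_ring (range var)"

definition linear_form :: "('v::finite, 'k::field) mpoly \<Rightarrow> bool" where
  "linear_form f \<longleftrightarrow>
     (\<exists>c :: 'v \<Rightarrow> 'k. f = (\<Sum>i\<in>UNIV. Poly_Mapping.single (Poly_Mapping.single i 1) (c i)))"


section \<open>Radicals and Krull dimension\<close>

definition ideal_rad :: "('a, 'b) ring_scheme \<Rightarrow> 'a set \<Rightarrow> 'a set" where
  "ideal_rad R I = {a \<in> carrier R. \<exists>n::nat. a [^]\<^bsub>R\<^esub> n \<in> I}"

text \<open>
  The supremum is \<open>\<infinity>\<close> if there are arbitrarily long chains. The zero ring, which has no prime
  ideals, gets dimension \<open>0\<close> here because \<open>Sup {} = 0\<close> in \<^typ>\<open>enat\<close>.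
\<close>

definition krull_dim :: "('a, 'b) ring_scheme \<Rightarrow> enat" where
  "krull_dim R = Sup {enat n | n. \<exists>P :: nat \<Rightarrow> 'a set.
     (\<forall>i\<le>n. primeideal (P i) R) \<and> (\<forall>i<n. P i \<subset> P (Suc i))}"


section \<open>Linear systems of parameters\<close>

definition linear_sop :: "('v::finite, 'k::field) mpoly set \<Rightarrow> ('v, 'k) mpoly list \<Rightarrow> bool" where
  "linear_sop I fs \<longleftrightarrow>
     (\<forall>f \<in> set fs. linear_form f) \<and>
     enat (length fs) = krull_dim (mpoly_ring Quot I) \<and>
     ideal_rad mpoly_ring (genideal mpoly_ring (I \<union> set fs)) = maximal_homogeneous_ideal"

definition zero_one_linear_sop ::
  "('v::finite, 'k::field) mpoly set \<Rightarrow> ('v, 'k) mpoly list \<Rightarrow> bool" where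
  "zero_one_linear_sop I fs \<longleftrightarrow>
     linear_sop I fs \<and> (\<forall>f \<in> set fs. \<forall>m. Poly_Mapping.lookup f m \<in> {0, 1})"


section \<open>Edge ideals\<close>

text \<open>A simple graph on the vertex set \<^term>\<open>UNIV :: 'v set\<close> is given by its set of edges \<open>{i, j}\<close>.\<close>

definition edge_ideal :: "'v set set \<Rightarrow> ('v, 'k::field) mpoly set" where
  "edge_ideal E = genideal mpoly_ring {var i * var j | i j. {i, j} \<in> E}"

definition complement_edges :: "'v set set \<Rightarrow> 'v set set" where
  "complement_edges E = {{i, j} | i j. i \<noteq> j \<and> {i, j} \<notin> E}"

text \<open>
  The vertices \<open>x\<^sub>1, \<dots>, x\<^sub>1\<^sub>1\<close> are the elements \<open>1, \<dots>, 11\<close> of the eleven-element type \<^typ>\<open>11\<close>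
  of residues modulo 11. Hence \<open>11 = 0\<close>; the arithmetic of the type plays no role.
\<close>

definition mycielski_groetzsch_edges :: "11 set set" where
  "mycielski_groetzsch_edges =
    {{1,2}, {2,3}, {3,4}, {1,5}, {4,5}, {2,6}, {5,6}, {1,7}, {3,7}, {2,8}, {4,8}, {3,9}, {5,9},
     {1,10}, {4,10}, {6,11}, {7,11}, {8,11}, {9,11}, {10,11}}"

lemma UNIV_11: "(UNIV :: 11 set) = {1, 2, 3, 4, 5, 6, 7, 8, 9, 10, 11}" (is "_ = ?A")
proof (rule sym, rule card_subset_eq)
  show "card ?A = CARD(11)" by simp
qed (rule finite, rule subset_UNIV)

lemma complement_edges_eqI:
  assumes "\<forall>x y. (x \<noteq> y \<and> {x, y} \<notin> M) \<longleftrightarrow> {x, y} \<in> E"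
    and "\<forall>z\<in>E. \<exists>x y. z = {x, y}"
  shows "complement_edges M = E"
proof -
  have "complement_edges M = {{x, y} | x y. {x, y} \<in> E}"
    unfolding complement_edges_def by (simp only: assms(1))
  also have "\<dots> = E"
    using assms(2) by fast
  finally show ?thesis .
qed

lemma complement_edges_mycielski_groetzsch_generic:
  fixes a b c d e f g h i j k :: 'v
  assumes dist: "distinct [a, b, c, d, e, f, g, h, i, j, k]"
    and univ: "UNIV = {a, b, c, d, e, f, g, h, i, j, k}"
  shows "complement_edges
    {{a,b}, {b,c}, {c,d}, {a,e}, {d,e}, {b,f}, {e,f}, {a,g}, {c,g}, {b,h}, {d,h}, {c,i}, {e,i},
     {a,j}, {d,j}, {f,k}, {g,k}, {h,k}, {i,k}, {j,k}} =
    {{a,c}, {a,d}, {b,d}, {b,e}, {c,e}, {a,f}, {a,h}, {a,i}, {b,g}, {b,i}, {b,j}, {c,f}, {c,h},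
     {c,j}, {d,f}, {d,g}, {d,i}, {e,g}, {e,h}, {e,j}, {a,k}, {b,k}, {c,k}, {d,k}, {e,k},
     {f,g}, {f,h}, {f,i}, {f,j}, {g,h}, {g,i}, {g,j}, {h,i}, {h,j}, {i,j}}"
   (is "complement_edges ?M = ?E")
proof -
  have "distinct (rev [a, b, c, d, e, f, g, h, i, j, k])"
    using dist by (simp only: distinct_rev)
  note ne = dist[simplified] this[simplified]
  have all: "(\<forall>x. P x) \<longleftrightarrow> P a \<and> P b \<and> P c \<and> P d \<and> P e \<and> P f \<and> P g \<and> P h \<and> P i \<and> P j \<and> P k" for P
  proof -
    have "(\<forall>x. P x) \<longleftrightarrow> (\<forall>x\<in>UNIV. P x)" by simp
    then show ?thesis by (simp only: univ ball_simps simp_thms)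
  qed
  show ?thesis
  proof (rule complement_edges_eqI)
    show "\<forall>x y. (x \<noteq> y \<and> {x, y} \<notin> ?M) \<longleftrightarrow> {x, y} \<in> ?E"
      unfolding all by (simp add: ne doubleton_eq_iff)
    show "\<forall>z\<in>?E. \<exists>x y. z = {x, y}"
      unfolding ball_simps by (intro conjI TrueI; (rule exI)+; rule refl)
  qed
qed

lemma complement_mycielski_groetzsch_edges:
  "complement_edges mycielski_groetzsch_edges =
    {{1,3}, {1,4}, {2,4}, {2,5}, {3,5}, {1,6}, {1,8}, {1,9}, {2,7}, {2,9}, {2,10}, {3,6}, {3,8},
     {3,10}, {4,6}, {4,7}, {4,9}, {5,7}, {5,8}, {5,10}, {1,11}, {2,11}, {3,11}, {4,11}, {5,11},
     {6,7}, {6,8}, {6,9}, {6,10}, {7,8}, {7,9}, {7,10}, {8,9}, {8,10}, {9,10}}"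
  unfolding mycielski_groetzsch_edges_def
  by (rule complement_edges_mycielski_groetzsch_generic [OF _ UNIV_11]) simp

lemma edge_ideal_complement_mycielski_groetzsch:
  fixes x :: "11 \<Rightarrow> (11, 'k::field) mpoly"
  defines "x \<equiv> var"
  shows "edge_ideal (complement_edges mycielski_groetzsch_edges) = genideal mpoly_ring
    {x 1 * x 3, x 1 * x 4, x 2 * x 4, x 2 * x 5, x 3 * x 5, x 1 * x 6, x 1 * x 8, x 1 * x 9,
     x 2 * x 7, x 2 * x 9, x 2 * x 10, x 3 * x 6, x 3 * x 8, x 3 * x 10,
     x 4 * x 6, x 4 * x 7, x 4 * x 9, x 5 * x 7, x 5 * x 8, x 5 * x 10,
     x 1 * x 11, x 2 * x 11, x 3 * x 11, x 4 * x 11, x 5 * x 11,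
     x 6 * x 7, x 6 * x 8, x 6 * x 9, x 6 * x 10, x 7 * x 8, x 7 * x 9, x 7 * x 10,
     x 8 * x 9, x 8 * x 10, x 9 * x 10}"
proof -
  have empty: "{x i * x j | i j. {i, j} \<in> {}} = {}"
    by simp
  have insert: "{x i * x j | i j. {i, j} \<in> insert {a, b} E} =
    insert (x a * x b) {x i * x j | i j. {i, j} \<in> E}" for a b :: 11 and E
    by (auto simp: doubleton_eq_iff mult.commute)
  show ?thesis
    unfolding edge_ideal_def complement_mycielski_groetzsch_edges x_def [symmetric]
    by (simp only: insert empty)
qed

end

theory Submission
  imports Defs
begin

text \<open>
  The minimal primes of \<open>I(G)\<close> correspond to the maximal independent sets of \<open>G\<close>, that is, to the
  edges of the triangle-free Mycielski-Groetzsch graph, so \<open>S/I(G)\<close> has dimension at most 2. Take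
  at most two linear forms with coefficients in \<open>{0, 1}\<close> and attach to each vertex the column of
  its coefficients. If the column of a vertex is zero, or two adjacent vertices of the
  Mycielski-Groetzsch graph have the same column, then \<open>I(G)\<close> and the forms have a common zero other
  than the origin. Hence the columns of a 0-1 linear system of parameters properly colour that graph
  with the at most three nonzero vectors of \<open>{0, 1}\<^sup>2\<close>, but its chromatic number is 4.
\<close>

section \<open>Chains of primes in a polynomial ring\<close>

lemma ring_of_type_algebra_simps [simp]:
  fixes x y :: "'a::comm_ring_1"
  shows "carrier (ring_of_type_algebra :: 'a ring) = UNIV"
    "x \<otimes>\<^bsub>ring_of_type_algebra\<^esub> y = x * y"
    "x \<oplus>\<^bsub>ring_of_type_algebra\<^esub> y = x + y"
    "\<one>\<^bsub>ring_of_type_algebra\<^esub> = (1::'a)"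
    "\<zero>\<^bsub>ring_of_type_algebra\<^esub> = (0::'a)"
  by (simp_all add: ring_of_type_algebra_def)

lemma ring_of_type_algebra_nat_pow [simp]:
  fixes x :: "'a::comm_ring_1"
  shows "x [^]\<^bsub>ring_of_type_algebra\<^esub> (n::nat) = x ^ n"
  by (induction n) (simp_all add: nat_pow_def mult.commute)

lemma ideal_add_closed:
  fixes I :: "'a::comm_ring_1 set"
  assumes "ideal I ring_of_type_algebra" and "a \<in> I" and "b \<in> I"
  shows "a + b \<in> I"
  using additive_subgroup.a_closed[OF ideal.axioms(1)[OF assms(1)] assms(2,3)] by simp

lemma ideal_sum_closed:
  fixes I :: "'a::comm_ring_1 set"
  assumes "ideal I ring_of_type_algebra" and "\<And>x. x \<in> A \<Longrightarrow> f x \<in> I"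
  shows "sum f A \<in> I"
proof -
  have "0 \<in> I"
    using additive_subgroup.zero_closed[OF ideal.axioms(1)[OF assms(1)]] by simp
  then show ?thesis
    using assms(2)
    by (induction A rule: infinite_finite_induct) (simp_all add: ideal_add_closed[OF assms(1)])
qed

lemma ideal_mult_closed:
  fixes I :: "'a::comm_ring_1 set"
  assumes "ideal I ring_of_type_algebra" and "a \<in> I"
  shows "x * a \<in> I" "a * x \<in> I"
  using ideal.I_l_closed[OF assms, of x] ideal.I_r_closed[OF assms, of x] by simp_all

lemma ideal_diff_closed:
  fixes I :: "'a::comm_ring_1 set"
  assumes "ideal I ring_of_type_algebra" and "a \<in> I" and "b \<in> I"
  shows "a - b \<in> I"
  using ideal_add_closed[OF assms(1,2) ideal_mult_closed(1)[OF assms(1,3), of "- 1"]] by simp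

lemma primeideal_mult_cancel:
  fixes P :: "'a::comm_ring_1 set"
  assumes "primeideal P ring_of_type_algebra" and "a * b \<in> P" and "a \<notin> P"
  shows "b \<in> P"
  using primeideal.I_prime[OF assms(1), of a b] assms(2,3) by simp

lemma primeideal_power_cancel:
  fixes P :: "'a::comm_ring_1 set"
  assumes "primeideal P ring_of_type_algebra" and "a ^ n * b \<in> P" and "a \<notin> P"
  shows "b \<in> P"
  using assms(2)
proof (induction n)
  case (Suc n)
  then have "a * (a ^ n * b) \<in> P" by (simp add: mult.assoc)
  then show ?case
    using Suc.IH primeideal_mult_cancel[OF assms(1)] assms(3) by blast
qed simp

lemma primeideal_no_unit:
  fixes P :: "'a::comm_ring_1 set"
  assumes "primeideal P ring_of_type_algebra" and "u dvd 1"
  shows "u \<notin> P"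
proof
  assume "u \<in> P"
  interpret primeideal P ring_of_type_algebra by fact
  obtain w where "1 = u * w" using assms(2) by (rule dvdE)
  then have "1 \<in> P" using ideal_mult_closed(2)[OF is_ideal \<open>u \<in> P\<close>, of w] by simp
  then have "P = UNIV" using one_imp_carrier by simp
  then show False using I_notcarr by simp
qed

text \<open>
  Elements that climb a chain of primes satisfy no polynomial relation with unit coefficients: only
  the exponent vectors with the least exponent of the first element survive modulo the next prime.
\<close>

lemma prime_chain_no_relation:
  fixes P :: "nat \<Rightarrow> 'a::comm_ring_1 set" and a :: "nat \<Rightarrow> 'a" and c :: "(nat \<Rightarrow> nat) \<Rightarrow> 'a"
  assumes prime: "\<And>i. i \<le> n \<Longrightarrow> primeideal (P i) ring_of_type_algebra"
    and sub: "\<And>i. i < n \<Longrightarrow> P i \<subseteq> P (Suc i)"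
    and a: "\<And>i. i < n \<Longrightarrow> a i \<in> P (Suc i) - P i"
    and "j \<le> n" and "finite E" and "E \<noteq> {}"
    and "\<And>e e'. \<lbrakk>e \<in> E; e' \<in> E; \<And>i. \<lbrakk>j \<le> i; i < n\<rbrakk> \<Longrightarrow> e i = e' i\<rbrakk> \<Longrightarrow> e = e'"
    and "\<And>e. e \<in> E \<Longrightarrow> c e dvd 1"
  shows "(\<Sum>e\<in>E. c e * (\<Prod>i=j..<n. a i ^ e i)) \<notin> P j"
  using assms(4-8)
proof (induction j arbitrary: E rule: inc_induct)
  case base
  \<comment> \<open>At \<open>j = n\<close> no index remains, so the separation hypothesis makes
    \<open>E\<close> a singleton and the sum is a single unit.\<close>
  obtain e where e: "e \<in> E" using base by blast
  then have "E = {e}" using base(3) by fastforce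
  then show ?case using primeideal_no_unit[OF prime[of n]] base(4) by simp
next
  case (step j)
  define m where "m = (LEAST k. k \<in> (\<lambda>e. e j) ` E)"
  define E' where "E' = {e \<in> E. e j = m}"
  define t where "t j e = c e * (\<Prod>i=j..<n. a i ^ e i)" for j e
  have m: "m \<in> (\<lambda>e. e j) ` E"
    unfolding m_def using step.prems(2) by (metis LeastI equals0I imageI)
  have m_le: "m \<le> e j" if "e \<in> E" for e
    unfolding m_def using that by (blast intro: Least_le)
  have idj: "ideal (P j) ring_of_type_algebra" "ideal (P (Suc j)) ring_of_type_algebra"
    using prime[of j] prime[of "Suc j"] step.hyps by (auto simp: primeideal_def)
  have factor: "t j e = a j ^ m * (a j ^ (e j - m) * t (Suc j) e)" if "e \<in> E" for e
  proof -
    have "a j ^ e j = a j ^ m * a j ^ (e j - m)"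
      using m_le[OF that] by (simp flip: power_add)
    then show ?thesis
      using step.hyps by (simp add: t_def prod.atLeast_Suc_lessThan ac_simps)
  qed
  have IH: "(\<Sum>e\<in>E'. t (Suc j) e) \<notin> P (Suc j)"
    unfolding t_def
  proof (rule step.IH)
    show "E' \<noteq> {}" using m by (auto simp: E'_def)
    show "e = e'" if "e \<in> E'" "e' \<in> E'" "\<And>i. \<lbrakk>Suc j \<le> i; i < n\<rbrakk> \<Longrightarrow> e i = e' i" for e e'
    proof (rule step.prems(3))
      \<comment> \<open>On \<open>E'\<close> the exponent of \<open>a j\<close> is constantly
        \<open>m\<close>, so agreement beyond \<open>j\<close> is agreement from \<open>j\<close>
        on.\<close>
      show "e i = e' i" if "j \<le> i" "i < n" for i
        using that \<open>e \<in> E'\<close> \<open>e' \<in> E'\<close> \<open>\<And>i. \<lbrakk>Suc j \<le> i; i < n\<rbrakk> \<Longrightarrow> e i = e' i\<close>[of i]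
        by (cases "i = j") (auto simp: E'_def)
    qed (use that in \<open>auto simp: E'_def\<close>)
  qed (use step.prems in \<open>auto simp: E'_def\<close>)
  show ?case
  proof
    assume "(\<Sum>e\<in>E. c e * (\<Prod>i=j..<n. a i ^ e i)) \<in> P j"
    then have "(\<Sum>e\<in>E. t j e) \<in> P j" by (simp add: t_def)
    moreover have "(\<Sum>e\<in>E. t j e) = a j ^ m * (\<Sum>e\<in>E. a j ^ (e j - m) * t (Suc j) e)"
      unfolding sum_distrib_left by (rule sum.cong) (auto simp: factor)
    ultimately have "(\<Sum>e\<in>E. a j ^ (e j - m) * t (Suc j) e) \<in> P j"
      using primeideal_power_cancel[OF prime[of j]] a[of j] step.hyps by auto
    then have "(\<Sum>e\<in>E. a j ^ (e j - m) * t (Suc j) e) \<in> P (Suc j)"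
      using sub step.hyps by blast
    \<comment> \<open>Outside \<open>E'\<close> a factor \<open>a j\<close> survives the division by
      \<open>a j ^ m\<close>, and \<open>a j\<close> lies in \<open>P (Suc j)\<close>.\<close>
    moreover have "(\<Sum>e\<in>E - E'. a j ^ (e j - m) * t (Suc j) e) \<in> P (Suc j)"
    proof (rule ideal_sum_closed[OF idj(2)])
      fix e assume "e \<in> E - E'"
      then have "e j - m \<noteq> 0" using m_le[of e] by (auto simp: E'_def)
      then obtain k where "e j - m = Suc k" using not0_implies_Suc by blast
      then have "a j ^ (e j - m) * t (Suc j) e = a j * (a j ^ k * t (Suc j) e)"
        by (simp add: mult.assoc)
      then show "a j ^ (e j - m) * t (Suc j) e \<in> P (Suc j)"
        using ideal_mult_closed(2)[OF idj(2)] a[of j] step.hyps by auto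
    qed
    moreover have "(\<Sum>e\<in>E. a j ^ (e j - m) * t (Suc j) e) =
        (\<Sum>e\<in>E - E'. a j ^ (e j - m) * t (Suc j) e) + (\<Sum>e\<in>E'. t (Suc j) e)"
    proof -
      have "(\<Sum>e\<in>E'. a j ^ (e j - m) * t (Suc j) e) = (\<Sum>e\<in>E'. t (Suc j) e)"
        by (rule sum.cong) (auto simp: E'_def)
      moreover have "E' \<subseteq> E" by (auto simp: E'_def)
      ultimately show ?thesis
        using sum.subset_diff[OF _ step.prems(1), of E' "\<lambda>e. a j ^ (e j - m) * t (Suc j) e"]
        by simp
    qed
    ultimately have "(\<Sum>e\<in>E'. t (Suc j) e) \<in> P (Suc j)"
      using ideal_diff_closed[OF idj(2), of "\<Sum>e\<in>E. a j ^ (e j - m) * t (Suc j) e"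
          "\<Sum>e\<in>E - E'. a j ^ (e j - m) * t (Suc j) e"]
      by simp
    then show False using IH by contradiction
  qed
qed

text \<open>Gaussian elimination, one equation at a time: a nonzero \<open>A e0 m\<close> is a pivot
  that removes the equation \<open>m\<close> together with the unknown \<open>c e0\<close>, and the
  strict inequality of cardinalities survives.\<close>

lemma underdetermined_system:
  fixes A :: "'e \<Rightarrow> 'm \<Rightarrow> 'k::field"
  assumes "finite M" and "finite E" and "card M < card E"
  shows "\<exists>c. (\<exists>e\<in>E. c e \<noteq> 0) \<and> (\<forall>m\<in>M. (\<Sum>e\<in>E. c e * A e m) = 0)"
  using assms
proof (induction M arbitrary: A E rule: finite_induct)
  case empty
  then have "E \<noteq> {}" by auto
  then show ?case by (intro exI[of _ "\<lambda>_. 1"]) auto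
next
  case (insert m M)
  show ?case
  proof (cases "\<forall>e\<in>E. A e m = 0")
    case True
    then show ?thesis using insert.IH[of E A] insert.prems insert.hyps by auto
  next
    case False
    then obtain e0 where e0: "e0 \<in> E" "A e0 m \<noteq> 0" by blast
    define B where "B e k = A e k - A e m / A e0 m * A e0 k" for e k
    have "finite (E - {e0})" "card M < card (E - {e0})"
      using insert.prems insert.hyps e0(1) by auto
    from insert.IH[OF this, of B] obtain c where c: "\<exists>e\<in>E - {e0}. c e \<noteq> 0"
      "\<And>k. k \<in> M \<Longrightarrow> (\<Sum>e\<in>E - {e0}. c e * B e k) = 0" by blast
    \<comment> \<open>Equation \<open>m\<close> forces the value \<open>- s\<close> at
      \<open>e0\<close>; with it, every other equation becomes one of the reduced system for
      \<open>B\<close>.\<close>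
    define s where "s = (\<Sum>e\<in>E - {e0}. c e * A e m) / A e0 m"
    define c' where "c' = c(e0 := - s)"
    have sum_c': "(\<Sum>e\<in>E. c' e * A e k) = (\<Sum>e\<in>E - {e0}. c e * A e k) - s * A e0 k" for k
    proof -
      have "(\<Sum>e\<in>E. c' e * A e k) = c' e0 * A e0 k + (\<Sum>e\<in>E - {e0}. c' e * A e k)"
        using e0(1) insert.prems(1) by (simp add: sum.remove)
      moreover have "(\<Sum>e\<in>E - {e0}. c' e * A e k) = (\<Sum>e\<in>E - {e0}. c e * A e k)"
        by (rule sum.cong) (auto simp: c'_def)
      ultimately show ?thesis by (simp add: c'_def)
    qed
    have "(\<Sum>e\<in>E. c' e * A e k) = 0" if "k \<in> insert m M" for k
    proof (cases "k = m")
      case True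
      then show ?thesis using e0(2) by (simp add: sum_c' s_def)
    next
      case False
      then have "0 = (\<Sum>e\<in>E - {e0}. c e * B e k)" using c(2) that by simp
      also have "\<dots> = (\<Sum>e\<in>E - {e0}. c e * A e k) - s * A e0 k"
        by (simp add: B_def s_def algebra_simps sum_subtractf sum_distrib_left sum_divide_distrib)
      finally show ?thesis by (simp add: sum_c')
    qed
    moreover have "\<exists>e\<in>E. c' e \<noteq> 0" using c(1) by (auto simp: c'_def)
    ultimately show ?thesis by blast
  qed
qed

section \<open>Monomials and bounds on their exponents\<close>

lemma poly_mapping_sum_single:
  "(\<Sum>m\<in>Poly_Mapping.keys p. Poly_Mapping.single m (Poly_Mapping.lookup p m)) = p"
  by (rule poly_mapping_eqI) (auto simp: lookup_sum lookup_single when_def in_keys_iff sum.delta')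

lemma lookup_single_0_mult:
  fixes p :: "('v, 'k::field) mpoly"
  shows "Poly_Mapping.lookup (Poly_Mapping.single 0 c * p) m = c * Poly_Mapping.lookup p m"
  by (simp add: mult_map_scale_conv_mult[symmetric] map.rep_eq when_def)

lemma single_eq_var_mult:
  fixes a :: "'k::field"
  assumes "Poly_Mapping.lookup m v \<noteq> 0"
  shows "Poly_Mapping.single m a = var v * Poly_Mapping.single (m - Poly_Mapping.single v 1) a"
proof -
  have "m = Poly_Mapping.single v 1 + (m - Poly_Mapping.single v 1)"
    using assms by (intro poly_mapping_eqI) (auto simp: lookup_add lookup_minus lookup_single when_def)
  then show ?thesis by (metis mult_single var_def mult_1)
qed

text \<open>Each exponent is bounded separately, rather than the total degree, so that the
  admissible monomials fill a box, which is counted by a plain power.\<close>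

definition exps_le :: "nat \<Rightarrow> ('v, 'k::field) mpoly \<Rightarrow> bool" where
  "exps_le d p \<longleftrightarrow> (\<forall>m\<in>Poly_Mapping.keys p. \<forall>v. Poly_Mapping.lookup m v \<le> d)"

lemma exps_le_mult: "exps_le (d + d') (p * q)" if "exps_le d p" "exps_le d' q"
  using that keys_mult[of p q] unfolding exps_le_def
  by (fastforce simp: lookup_add intro: add_mono)

lemma exps_le_power: "exps_le d p \<Longrightarrow> exps_le (n * d) (p ^ n)"
proof (induction n)
  case 0
  then show ?case by (simp add: exps_le_def)
next
  case (Suc n)
  then show ?case using exps_le_mult by fastforce
qed

lemma exps_le_prod: "(\<And>i. i \<in> A \<Longrightarrow> exps_le (d i) (p i)) \<Longrightarrow> exps_le (sum d A) (prod p A)"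
  by (induction A rule: infinite_finite_induct) (simp_all add: exps_le_mult, simp_all add: exps_le_def)

lemma exps_le_mono: "exps_le d p \<Longrightarrow> d \<le> d' \<Longrightarrow> exps_le d' p"
  unfolding exps_le_def using order_trans by blast

lemma ex_exps_le: "\<exists>d. exps_le d (p :: ('v::finite, 'k::field) mpoly)"
proof -
  define A where "A = (\<lambda>(m, v). Poly_Mapping.lookup m v) ` (Poly_Mapping.keys p \<times> UNIV)"
  have "finite A" by (simp add: A_def)
  \<comment> \<open>For \<open>p = 0\<close> the set \<open>A\<close> is empty and
    \<open>Max A\<close> is unspecified, but the bound then holds vacuously.\<close>
  then have "exps_le (Max A) p"
    unfolding exps_le_def by (auto intro!: Max_ge simp: A_def)
  then show ?thesis ..
qed

text \<open>Exponents outside \<open>V\<close> vanish, so restriction to \<open>V\<close> embeds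
  these monomials into the functions from \<open>V\<close> to \<open>{..b}\<close>.\<close>

lemma card_bounded_monomials:
  fixes V :: "'v::finite set" and b :: nat
  defines "M \<equiv> {m :: 'v \<Rightarrow>\<^sub>0 nat. \<forall>v. Poly_Mapping.lookup m v \<le> (if v \<in> V then b else 0)}"
  shows "finite M" and "card M \<le> (b + 1) ^ card V"
proof -
  define F where "F = (\<Pi>\<^sub>E v\<in>V. {..b})"
  have inj: "inj_on (\<lambda>m. restrict (Poly_Mapping.lookup m) V) M"
  proof (rule inj_onI, rule poly_mapping_eqI)
    fix m m' v
    assume "m \<in> M" "m' \<in> M" "restrict (Poly_Mapping.lookup m) V = restrict (Poly_Mapping.lookup m') V"
    then show "Poly_Mapping.lookup m v = Poly_Mapping.lookup m' v"
      unfolding M_def by (cases "v \<in> V") (auto dest: fun_cong[of _ _ v] dest!: spec[of _ v])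
  qed
  moreover have sub: "(\<lambda>m. restrict (Poly_Mapping.lookup m) V) ` M \<subseteq> F"
  proof (rule image_subsetI)
    fix m assume "m \<in> M"
    then have "Poly_Mapping.lookup m v \<le> b" if "v \<in> V" for v
      using that unfolding M_def by (auto dest: spec[of _ v])
    then show "restrict (Poly_Mapping.lookup m) V \<in> F" by (simp add: F_def)
  qed
  moreover have fin: "finite F" by (simp add: F_def finite_PiE)
  ultimately show "finite M" by (meson finite_imageD finite_subset)
  have "card M \<le> card F" using inj sub fin by (rule card_inj_on_le)
  then show "card M \<le> (b + 1) ^ card V" by (simp add: F_def card_PiE)
qed

text \<open>
  Dimension count: modulo \<open>P 0\<close> only monomials in the \<open>d\<close> variables outside \<open>P 0\<close> survive. The \<open>N\<^sup>n\<close>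
  products of powers below \<open>N\<close> of \<open>n > d\<close> elements lie in the span of \<open>O(N\<^sup>d)\<close> such monomials,
  so for large \<open>N\<close> they are linearly dependent modulo \<open>P 0\<close>.
\<close>

lemma prime_chain_length_le:
  fixes P :: "nat \<Rightarrow> ('v::finite, 'k::field) mpoly set"
  assumes prime: "\<And>i. i \<le> n \<Longrightarrow> primeideal (P i) mpoly_ring"
    and chain: "\<And>i. i < n \<Longrightarrow> P i \<subset> P (Suc i)"
  shows "n \<le> card {v. var v \<notin> P 0}"
proof (rule ccontr)
  define V where "V = {v. var v \<notin> P 0}"
  assume "\<not> n \<le> card {v. var v \<notin> P 0}"
  then have dn: "card V < n" by (simp add: V_def)
  have "\<forall>i<n. \<exists>x. x \<in> P (Suc i) - P i" using chain by blast
  then obtain a where a: "\<And>i. i < n \<Longrightarrow> a i \<in> P (Suc i) - P i" by metis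
  have "\<exists>D. \<forall>i<n. exps_le D (a i)"
  proof -
    have "\<forall>i. \<exists>d. exps_le d (a i)" by (simp add: ex_exps_le)
    from choice[OF this] obtain f where f: "\<forall>i. exps_le (f i) (a i)" by blast
    have "f i \<le> Max (f ` {..<n})" if "i < n" for i
      using that by (intro Max_ge) auto
    then have "\<forall>i<n. exps_le (Max (f ` {..<n})) (a i)"
      using f exps_le_mono by blast
    then show ?thesis by (rule exI)
  qed
  then obtain D where D: "\<And>i. i < n \<Longrightarrow> exps_le D (a i)" by blast
  \<comment> \<open>Large enough for
    \<open>((n * D + 1) * N) ^ card V < N * N ^ card V \<le> N ^ n\<close>, which lets the products
    outnumber the monomials in \<open>M\<close>.\<close>
  define N where "N = (n * D + 1) ^ card V + 1"
  have N: "(n * D + 1) ^ card V < N" "0 < N" by (simp_all add: N_def)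
  define E where "E = (\<Pi>\<^sub>E i\<in>{..<n}. {..<N})"
  define mon where "mon e = (\<Prod>i=0..<n. a i ^ e i)" for e
  define M where "M = {m :: 'v \<Rightarrow>\<^sub>0 nat. \<forall>v. Poly_Mapping.lookup m v \<le> (if v \<in> V then n * D * N else 0)}"
  have finE: "finite E" by (simp add: E_def finite_PiE)
  have "card M \<le> (n * D * N + 1) ^ card V"
    unfolding M_def by (rule card_bounded_monomials)
  also have "\<dots> \<le> ((n * D + 1) * N) ^ card V"
    by (rule power_mono) (use N(2) in simp_all)
  also have "\<dots> < N * N ^ card V"
    unfolding power_mult_distrib using N by (intro mult_strict_right_mono) simp_all
  also have "\<dots> \<le> N ^ n"
    using dn power_increasing[of "Suc (card V)" n N] N(2) by simp
  also have "\<dots> = card E" by (simp add: E_def card_PiE)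
  finally have "card M < card E" .
  moreover have "finite M" unfolding M_def by (rule card_bounded_monomials)
  ultimately obtain c where c: "\<exists>e\<in>E. c e \<noteq> 0"
    "\<And>m. m \<in> M \<Longrightarrow> (\<Sum>e\<in>E. c e * Poly_Mapping.lookup (mon e) m) = 0"
    using underdetermined_system[of M E "\<lambda>e. Poly_Mapping.lookup (mon e)"] finE by blast
  \<comment> \<open>By the choice of \<open>c\<close>, no monomial of \<open>M\<close> occurs in
    \<open>q\<close>. Exponents in \<open>q\<close> are at most \<open>n * D * N\<close>, so each
    monomial that does occur contains a variable outside \<open>V\<close>, that is, one in
    \<open>P 0\<close>.\<close>
  define q where "q = (\<Sum>e\<in>E. Poly_Mapping.single 0 (c e) * mon e)"
  have lookup_q: "Poly_Mapping.lookup q m = (\<Sum>e\<in>E. c e * Poly_Mapping.lookup (mon e) m)" for m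
    by (simp add: q_def lookup_sum lookup_single_0_mult)
  have mon_le: "exps_le (n * D * N) (mon e)" if "e \<in> E" for e
  proof (rule exps_le_mono)
    show "exps_le (\<Sum>i=0..<n. e i * D) (mon e)"
      unfolding mon_def by (rule exps_le_prod) (simp add: D exps_le_power)
    have "(\<Sum>i=0..<n. e i * D) \<le> (\<Sum>i=0..<n. N * D)"
      using that by (intro sum_mono mult_right_mono) (auto simp: E_def PiE_iff less_imp_le)
    then show "(\<Sum>i=0..<n. e i * D) \<le> n * D * N" by (simp add: ac_simps)
  qed
  have id0: "ideal (P 0) mpoly_ring" using prime[of 0] by (simp add: primeideal_def)
  have "(\<Sum>m\<in>Poly_Mapping.keys q. Poly_Mapping.single m (Poly_Mapping.lookup q m)) \<in> P 0"
  proof (rule ideal_sum_closed[OF id0])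
    fix m assume m: "m \<in> Poly_Mapping.keys q"
    then have "(\<Sum>e\<in>E. c e * Poly_Mapping.lookup (mon e) m) \<noteq> 0"
      by (simp add: in_keys_iff lookup_q)
    moreover from this obtain e where "e \<in> E" "c e * Poly_Mapping.lookup (mon e) m \<noteq> 0"
      by (rule sum.not_neutral_contains_not_neutral)
    then have "\<forall>v. Poly_Mapping.lookup m v \<le> n * D * N"
      using mon_le[of e] by (simp add: exps_le_def in_keys_iff)
    moreover have "m \<notin> M" using calculation(1) c(2) by blast
    ultimately obtain v where "v \<notin> V" "Poly_Mapping.lookup m v \<noteq> 0"
      by (auto simp: M_def split: if_splits)
    then show "Poly_Mapping.single m (Poly_Mapping.lookup q m) \<in> P 0"
      using ideal_mult_closed(2)[OF id0] by (simp add: V_def single_eq_var_mult[of m v])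
  qed
  then have "q \<in> P 0" by (simp only: poly_mapping_sum_single)
  \<comment> \<open>Zero terms are dropped because \<open>prime_chain_no_relation\<close> asks for
    unit coefficients; nonzero constants are units.\<close>
  moreover have "q = (\<Sum>e\<in>{e \<in> E. c e \<noteq> 0}. Poly_Mapping.single 0 (c e) * mon e)"
    unfolding q_def by (rule sum.mono_neutral_right) (auto simp: finE)
  moreover have "(\<Sum>e\<in>{e \<in> E. c e \<noteq> 0}. Poly_Mapping.single 0 (c e) * mon e) \<notin> P 0"
    unfolding mon_def
  proof (rule prime_chain_no_relation[where n = n])
    show "e = e'" if "e \<in> {e \<in> E. c e \<noteq> 0}" "e' \<in> {e \<in> E. c e \<noteq> 0}"
      "\<And>i. \<lbrakk>0 \<le> i; i < n\<rbrakk> \<Longrightarrow> e i = e' i" for e e'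
      using that by (auto simp: E_def intro: PiE_ext)
    show "Poly_Mapping.single 0 (c e) dvd (1 :: ('v, 'k) mpoly)" if "e \<in> {e \<in> E. c e \<noteq> 0}" for e
    proof
      show "1 = Poly_Mapping.single 0 (c e) * Poly_Mapping.single 0 (inverse (c e))"
        using that by (simp add: mult_single)
    qed
  qed (use prime chain a c(1) finE in auto)
  ultimately show False by simp
qed

section \<open>Prime chains and dimension of quotient rings\<close>

lemma (in ideal) quotient_prime_chain_vimage:
  assumes "cring R"
    and prime: "\<And>i. i \<le> n \<Longrightarrow> primeideal (P i) (R Quot I)"
    and chain: "\<And>i. i < n \<Longrightarrow> P i \<subset> P (Suc i)"
  defines "Q \<equiv> \<lambda>i. {r \<in> carrier R. I +> r \<in> P i}"
  shows "\<And>i. i \<le> n \<Longrightarrow> primeideal (Q i) R" "\<And>i. i < n \<Longrightarrow> Q i \<subset> Q (Suc i)" "I \<subseteq> Q 0"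
proof -
  fix i
  assume "i \<le> n"
  then show "primeideal (Q i) R"
    unfolding Q_def using ring_hom_ring.primeideal_vimage[OF rcos_ring_hom_ring assms(1)] prime
    by simp
next
  fix i
  assume i: "i < n"
  then obtain y where y: "y \<in> P (Suc i)" "y \<notin> P i" using chain by blast
  have "additive_subgroup (P (Suc i)) (R Quot I)"
    using prime[of "Suc i"] i by (simp add: ideal_def primeideal_def)
  \<comment> \<open>The quotient map is onto, so an element separating \<open>P i\<close> from
    \<open>P (Suc i)\<close> has a preimage, which keeps the inclusion strict.\<close>
  from additive_subgroup.a_subset[OF this] y(1) have "y \<in> a_rcosets I"
    by (auto simp: FactRing_def)
  then obtain r where "r \<in> carrier R" "y = I +> r"
    unfolding A_RCOSETS_def' by blast
  then have "r \<in> Q (Suc i) - Q i" using y by (simp add: Q_def)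
  moreover have "Q i \<subseteq> Q (Suc i)" using chain[OF i] unfolding Q_def by blast
  ultimately show "Q i \<subset> Q (Suc i)" by blast
next
  have "additive_subgroup (P 0) (R Quot I)"
    using prime[of 0] by (simp add: ideal_def primeideal_def)
  from additive_subgroup.zero_closed[OF this] have "I \<in> P 0"
    by (simp add: FactRing_def)
  then show "I \<subseteq> Q 0"
    using a_rcos_zero[OF is_ideal] Icarr by (auto simp: Q_def)
qed

text \<open>A chain of primes is pulled back to the polynomial ring. The variables outside its
  lowest prime form an independent set, since the product of two adjacent ones lies in the edge
  ideal and hence in that prime. Their number bounds the length of the chain.\<close>

lemma krull_dim_quot_edge_ideal_le:
  fixes E :: "'v::finite set set"
  assumes "\<And>V. \<forall>i\<in>V. \<forall>j\<in>V. i \<noteq> j \<longrightarrow> {i, j} \<notin> E \<Longrightarrow> card V \<le> d"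
  shows "krull_dim (mpoly_ring Quot (edge_ideal E :: ('v, 'k::field) mpoly set)) \<le> enat d"
  unfolding krull_dim_def
proof (rule Sup_least)
  let ?R = "mpoly_ring :: ('v, 'k) mpoly ring"
  let ?I = "edge_ideal E :: ('v, 'k) mpoly set"
  have R: "cring ?R" "ring ?R" by (rule cring_from_type_algebra ring_from_type_algebra)+
  have gens: "{var i * var j | i j. {i, j} \<in> E} \<subseteq> ?I"
    unfolding edge_ideal_def by (rule ring.genideal_self[OF R(2)]) simp
  have I: "ideal ?I ?R"
    unfolding edge_ideal_def by (rule ring.genideal_ideal[OF R(2)]) simp
  fix x
  assume "x \<in> {enat n |n. \<exists>P. (\<forall>i\<le>n. primeideal (P i) (?R Quot ?I)) \<and> (\<forall>i<n. P i \<subset> P (Suc i))}"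
  then obtain n P where x: "x = enat n"
    and P: "\<And>i. i \<le> n \<Longrightarrow> primeideal (P i) (?R Quot ?I)" "\<And>i. i < n \<Longrightarrow> P i \<subset> P (Suc i)"
    by blast
  define Q where "Q i = {r \<in> carrier ?R. ?I +>\<^bsub>?R\<^esub> r \<in> P i}" for i
  note lift = ideal.quotient_prime_chain_vimage[where P = P and n = n, OF I R(1) P, folded Q_def]
  have Q: "primeideal (Q i) ?R" if "i \<le> n" for i
    using lift(1) that by blast
  have chain: "Q i \<subset> Q (Suc i)" if "i < n" for i
    using lift(2) that by blast
  have I_sub: "?I \<subseteq> Q 0"
    using lift(3) by blast
  have "n \<le> card {v. var v \<notin> Q 0}"
    using Q chain by (rule prime_chain_length_le)
  also have "\<dots> \<le> d"
  proof (rule assms, intro ballI impI notI)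
    fix i j assume ij: "i \<in> {v. var v \<notin> Q 0}" "j \<in> {v. var v \<notin> Q 0}" "{i, j} \<in> E"
    then have "var i * var j \<in> Q 0" using gens I_sub by blast
    then have "var j \<in> Q 0"
      using ij(1) by (intro primeideal_mult_cancel[OF Q[of 0], of "var i" "var j"]) simp_all
    then show False using ij(2) by simp
  qed
  finally show "x \<le> enat d" by (simp add: x)
qed

section \<open>Common zeros\<close>

definition mpoly_eval :: "('v::finite \<Rightarrow> 'k::field) \<Rightarrow> ('v, 'k) mpoly \<Rightarrow> 'k" where
  "mpoly_eval a p = (\<Sum>m\<in>Poly_Mapping.keys p.
    Poly_Mapping.lookup p m * (\<Prod>v\<in>UNIV. a v ^ Poly_Mapping.lookup m v))"

lemma mpoly_eval_superset:
  assumes "finite A" and "Poly_Mapping.keys p \<subseteq> A"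
  shows "mpoly_eval a p = (\<Sum>m\<in>A. Poly_Mapping.lookup p m * (\<Prod>v\<in>UNIV. a v ^ Poly_Mapping.lookup m v))"
  unfolding mpoly_eval_def using assms by (intro sum.mono_neutral_left) (auto simp: in_keys_iff)

lemma mpoly_eval_add: "mpoly_eval a (p + q) = mpoly_eval a p + mpoly_eval a q"
proof -
  define A where "A = Poly_Mapping.keys p \<union> Poly_Mapping.keys q"
  have "finite A" "Poly_Mapping.keys p \<subseteq> A" "Poly_Mapping.keys q \<subseteq> A"
    "Poly_Mapping.keys (p + q) \<subseteq> A"
    using keys_add[of p q] by (auto simp: A_def)
  then show ?thesis
    by (simp add: mpoly_eval_superset[of A] lookup_add algebra_simps sum.distrib)
qed

lemma mpoly_eval_zero [simp]: "mpoly_eval a 0 = 0"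
  by (simp add: mpoly_eval_def)

lemma mpoly_eval_sum: "mpoly_eval a (sum f A) = (\<Sum>x\<in>A. mpoly_eval a (f x))"
  by (induction A rule: infinite_finite_induct) (simp_all add: mpoly_eval_add)

lemma mpoly_eval_single:
  "mpoly_eval a (Poly_Mapping.single m c) = c * (\<Prod>v\<in>UNIV. a v ^ Poly_Mapping.lookup m v)"
  using mpoly_eval_superset[of "{m}" "Poly_Mapping.single m c" a] by simp

lemma mpoly_eval_mult: "mpoly_eval a (p * q) = mpoly_eval a p * mpoly_eval a q"
proof -
  let ?s = "\<lambda>p m. Poly_Mapping.single m (Poly_Mapping.lookup p m)"
  have "p * q = (\<Sum>m\<in>Poly_Mapping.keys p. \<Sum>m'\<in>Poly_Mapping.keys q. ?s p m * ?s q m')"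
    by (simp flip: sum_product add: poly_mapping_sum_single)
  then have "mpoly_eval a (p * q) =
      (\<Sum>m\<in>Poly_Mapping.keys p. \<Sum>m'\<in>Poly_Mapping.keys q. mpoly_eval a (?s p m) * mpoly_eval a (?s q m'))"
    by (simp add: mpoly_eval_sum mult_single mpoly_eval_single lookup_add power_add prod.distrib ac_simps)
  also have "\<dots> = mpoly_eval a p * mpoly_eval a q"
    by (simp flip: sum_product mpoly_eval_sum add: poly_mapping_sum_single)
  finally show ?thesis .
qed

lemma mpoly_eval_one [simp]: "mpoly_eval a 1 = 1"
  using mpoly_eval_single[of a 0 1] by simp

lemma mpoly_eval_power: "mpoly_eval a (p ^ n) = mpoly_eval a p ^ n"
  by (induction n) (simp_all add: mpoly_eval_mult)

lemma prod_power_lookup_single: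
  fixes a :: "'v::finite \<Rightarrow> 'k::field"
  shows "(\<Prod>w\<in>UNIV. a w ^ Poly_Mapping.lookup (Poly_Mapping.single v 1) w) = a v"
proof -
  have "(\<Prod>w\<in>UNIV. a w ^ Poly_Mapping.lookup (Poly_Mapping.single v 1) w) =
      (\<Prod>w\<in>UNIV. if w = v then a w else 1)"
    by (rule prod.cong) (auto simp: lookup_single)
  then show ?thesis by simp
qed

lemma mpoly_eval_var [simp]: "mpoly_eval a (var v) = a v"
  by (simp add: var_def mpoly_eval_single prod_power_lookup_single[unfolded One_nat_def])

lemma mpoly_eval_linear_form:
  assumes "linear_form f"
  shows "mpoly_eval a f = (\<Sum>v\<in>UNIV. Poly_Mapping.lookup f (Poly_Mapping.single v 1) * a v)"
proof -
  obtain c where c: "f = (\<Sum>v\<in>UNIV. Poly_Mapping.single (Poly_Mapping.single v 1) (c v))"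
    using assms unfolding linear_form_def by blast
  have "Poly_Mapping.single w (1::nat) = Poly_Mapping.single v 1 \<longleftrightarrow> w = v" for v w :: 'a
    by (metis lookup_single_eq lookup_single_not_eq one_neq_zero)
  then have "Poly_Mapping.lookup f (Poly_Mapping.single v 1) = c v" for v
    by (simp add: c lookup_sum lookup_single when_def)
  moreover have "mpoly_eval a f = (\<Sum>v\<in>UNIV. c v * a v)"
    by (simp only: c mpoly_eval_sum mpoly_eval_single prod_power_lookup_single)
  ultimately show ?thesis by simp
qed

text \<open>Evaluation at \<open>a\<close> is a ring homomorphism, so its kernel is an ideal;
  containing \<open>G\<close>, it contains the ideal generated by \<open>G\<close>.\<close>

lemma mpoly_eval_genideal_eq_0:
  assumes "\<And>g. g \<in> G \<Longrightarrow> mpoly_eval a g = 0" and "p \<in> genideal mpoly_ring G"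
  shows "mpoly_eval a p = 0"
proof -
  let ?R = "mpoly_ring :: ('a, 'b) mpoly ring"
  let ?S = "ring_of_type_algebra :: 'b ring"
  have R: "ring ?R" and S: "ring ?S" by (rule ring_from_type_algebra)+
  have "mpoly_eval a \<in> ring_hom ?R ?S"
    by (rule ring_hom_memI) (simp_all add: mpoly_eval_add mpoly_eval_mult)
  then have "ideal (a_kernel ?R ?S (mpoly_eval a)) ?R"
    by (rule ring_hom_ring.kernel_is_ideal[OF ring_hom_ringI2[OF R S]])
  moreover have "a_kernel ?R ?S (mpoly_eval a) = {q. mpoly_eval a q = 0}"
    by (simp add: a_kernel_def')
  ultimately have "genideal ?R G \<subseteq> {q. mpoly_eval a q = 0}"
    using assms(1) by (intro ring.genideal_minimal[OF R]) auto
  then show ?thesis using assms(2) by blast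
qed

text \<open>The radical condition puts a power of each variable into the ideal generated by the edge
  ideal and the forms. That power vanishes at any common zero \<open>a\<close>, and a field has no
  nonzero nilpotents.\<close>

lemma linear_sop_only_zero:
  fixes fs :: "('v::finite, 'k::field) mpoly list"
  assumes sop: "linear_sop (edge_ideal E) fs"
    and edges: "\<And>i j. {i, j} \<in> E \<Longrightarrow> a i * a j = 0"
    and forms: "\<And>f. f \<in> set fs \<Longrightarrow> (\<Sum>v\<in>UNIV. Poly_Mapping.lookup f (Poly_Mapping.single v 1) * a v) = 0"
  shows "a v = 0"
proof -
  interpret R: ring "mpoly_ring :: ('v, 'k) mpoly ring" by (rule ring_from_type_algebra)
  have "var v \<in> (maximal_homogeneous_ideal :: ('v, 'k) mpoly set)"
    unfolding maximal_homogeneous_ideal_def using R.genideal_self[of "range var"] by auto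
  then obtain n where n: "var v ^ n \<in> genideal mpoly_ring (edge_ideal E \<union> set fs)"
    using sop unfolding linear_sop_def ideal_rad_def by auto
  have "mpoly_eval a p = 0" if "p \<in> edge_ideal E" for p
    using _ that[unfolded edge_ideal_def]
    by (rule mpoly_eval_genideal_eq_0) (use edges in \<open>auto simp: mpoly_eval_mult\<close>)
  moreover have "mpoly_eval a f = 0" if "f \<in> set fs" for f
  proof -
    have "linear_form f" using that sop by (simp add: linear_sop_def)
    then show ?thesis using forms[OF that] by (simp only: mpoly_eval_linear_form)
  qed
  ultimately have "mpoly_eval a (var v ^ n) = 0"
    by (intro mpoly_eval_genideal_eq_0[OF _ n]) blast
  \<comment> \<open>The exponent \<open>n = 0\<close> is excluded, as the power would evaluate to
    1.\<close>
  then show "a v = 0" by (simp add: mpoly_eval_power)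
qed

text \<open>Otherwise the unit vector at \<open>v\<close> would be a common zero: only a loop
  \<open>{v}\<close> could give an edge product that does not vanish there.\<close>

lemma linear_sop_column_nonzero:
  fixes fs :: "('v::finite, 'k::field) mpoly list"
  assumes "linear_sop (edge_ideal E) fs" and "{v} \<notin> E"
  shows "\<exists>f\<in>set fs. Poly_Mapping.lookup f (Poly_Mapping.single v 1) \<noteq> 0"
proof (rule ccontr)
  assume contr: "\<not> ?thesis"
  have "of_bool (v = v) = (0 :: 'k)"
  proof (rule linear_sop_only_zero[OF assms(1), where a = "\<lambda>w. of_bool (w = v)"])
    show "of_bool (i = v) * of_bool (j = v) = (0 :: 'k)" if "{i, j} \<in> E" for i j
      using that assms(2) by auto
  qed (use contr in auto)
  then show False by simp
qed

text \<open>If the columns agreed, the vector with 1 at \<open>i\<close> and -1 at \<open>j\<close>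
  would be a common zero: each form takes there the difference of its two coefficients, and no edge
  lies within the support.\<close>

lemma linear_sop_columns_differ:
  fixes fs :: "('v::finite, 'k::field) mpoly list"
  assumes "linear_sop (edge_ideal E) fs" and "\<And>v. {v} \<notin> E" and "i \<noteq> j" and "{i, j} \<notin> E"
  shows "\<exists>f\<in>set fs. Poly_Mapping.lookup f (Poly_Mapping.single i 1) \<noteq>
    Poly_Mapping.lookup f (Poly_Mapping.single j 1)"
proof (rule ccontr)
  define a :: "'v \<Rightarrow> 'k" where "a w = (if w = i then 1 else if w = j then - 1 else 0)" for w
  assume contr: "\<not> ?thesis"
  have "a i = 0"
  proof (rule linear_sop_only_zero[OF assms(1)])
    show "a k * a l = 0" if "{k, l} \<in> E" for k l
      using that assms(2-4) by (auto simp: a_def insert_commute)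
    fix f assume "f \<in> set fs"
    let ?c = "\<lambda>w. Poly_Mapping.lookup f (Poly_Mapping.single w 1)"
    have "(\<Sum>w\<in>UNIV. ?c w * a w) = (\<Sum>w\<in>UNIV. (if w = i then ?c w else 0) - (if w = j then ?c w else 0))"
      by (rule sum.cong) (use assms(3) in \<open>auto simp: a_def\<close>)
    also have "\<dots> = ?c i - ?c j" by (simp add: sum_subtractf)
    finally show "(\<Sum>w\<in>UNIV. ?c w * a w) = 0" using contr \<open>f \<in> set fs\<close> by simp
  qed
  then show False by (simp add: a_def)
qed

section \<open>Colourings of the Mycielski-Groetzsch graph\<close>

text \<open>The cycle is odd: with two colours, \<open>g1\<close> and \<open>g2\<close> exhaust
  \<open>C\<close>, so the colours alternate and \<open>g5\<close> would equal
  \<open>g1\<close>.\<close>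

lemma five_cycle_not_2_colorable:
  assumes "finite C" and "{g1, g2, g3, g4, g5} \<subseteq> C"
    and "g1 \<noteq> g2" "g2 \<noteq> g3" "g3 \<noteq> g4" "g4 \<noteq> g5" "g5 \<noteq> g1"
  shows "card C \<ge> 3"
proof (rule ccontr)
  assume "\<not> card C \<ge> 3"
  moreover have "g \<in> {g1, g2}" if "g \<in> C" "card C < 3" for g
  proof (rule ccontr)
    assume "g \<notin> {g1, g2}"
    then have "card {g, g1, g2} = 3" using assms(3) by auto
    moreover have "{g, g1, g2} \<subseteq> C" using that assms(2) by auto
    from card_mono[OF assms(1) this] have "card {g, g1, g2} \<le> card C" .
    ultimately show False using that(2) by linarith
  qed
  ultimately have "g3 \<in> {g1, g2}" "g4 \<in> {g1, g2}" "g5 \<in> {g1, g2}" using assms(2) by auto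
  then show False using assms(3-) by auto
qed

text \<open>
  Mycielski's argument: recolouring every vertex of the outer 5-cycle that shares the colour of
  the apex \<open>11\<close> with the colour of its shadow among \<open>6, \<dots>, 10\<close> frees that colour on the cycle.
\<close>

lemma groetzsch_not_3_colorable:
  fixes f :: "11 \<Rightarrow> 'c"
  assumes proper: "\<And>i j. {i, j} \<in> mycielski_groetzsch_edges \<Longrightarrow> f i \<noteq> f j"
    and "finite C" and "range f \<subseteq> C"
  shows "card C \<ge> 4"
proof -
  \<comment> \<open>Here \<open>s\<close> stands for the shadow of \<open>i\<close>: 6, ..., 10 have
    the same neighbours on the cycle as 1, ..., 5 respectively. Adjacent vertices of the cycle never
    both have the colour of 11, so the recoloured cycle stays proper.\<close>
  define g where "g i s = (if f i = f 11 then f s else f i)" for i s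
  have ne: "f 1 \<noteq> f 2" "f 2 \<noteq> f 3" "f 3 \<noteq> f 4" "f 1 \<noteq> f 5" "f 4 \<noteq> f 5"
    "f 2 \<noteq> f 6" "f 5 \<noteq> f 6" "f 1 \<noteq> f 7" "f 3 \<noteq> f 7" "f 2 \<noteq> f 8" "f 4 \<noteq> f 8"
    "f 3 \<noteq> f 9" "f 5 \<noteq> f 9" "f 1 \<noteq> f 10" "f 4 \<noteq> f 10"
    "f 6 \<noteq> f 11" "f 7 \<noteq> f 11" "f 8 \<noteq> f 11" "f 9 \<noteq> f 11" "f 10 \<noteq> f 11"
    by (rule proper, simp only: mycielski_groetzsch_edges_def insert_iff simp_thms)+
  have "card (C - {f 11}) \<ge> 3"
  proof (rule five_cycle_not_2_colorable)
    show "{g 1 6, g 2 7, g 3 8, g 4 9, g 5 10} \<subseteq> C - {f 11}"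
      using assms(3) ne by (auto simp: g_def)
    show "finite (C - {f 11})" using assms(2) by simp
  qed (use ne in \<open>auto simp: g_def\<close>)
  moreover have "f 11 \<in> C" using assms(3) by auto
  ultimately show ?thesis using assms(2) by simp
qed

text \<open>A finite check over the 20 edges \<open>{i, j}\<close> in both orientations. Coinciding
  vertices are covered: \<open>i = j = k\<close> excludes loops.\<close>

lemma groetzsch_no_triangle:
  assumes "{i, j} \<in> mycielski_groetzsch_edges" "{i, k} \<in> mycielski_groetzsch_edges"
  shows "{j, k} \<notin> mycielski_groetzsch_edges"
  using assms(1)
  unfolding mycielski_groetzsch_edges_def insert_iff empty_iff simp_thms doubleton_eq_iff
  using assms(2)
  by (elim disjE conjE; hypsubst; auto simp: mycielski_groetzsch_edges_def doubleton_eq_iff)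

text \<open>Cliques here are the independent sets of the complement, so this bounds the dimension by
  2.\<close>

lemma card_groetzsch_clique_le:
  assumes "\<forall>i\<in>V. \<forall>j\<in>V. i \<noteq> j \<longrightarrow> {i, j} \<in> mycielski_groetzsch_edges"
  shows "card V \<le> 2"
proof (rule ccontr)
  assume "\<not> card V \<le> 2"
  then have "3 \<le> card V" by simp
  then obtain T where "T \<subseteq> V" "card T = 3" by (rule obtain_subset_with_card_n)
  moreover from this obtain i j k where "T = {i, j, k}" "i \<noteq> j" "i \<noteq> k" "j \<noteq> k"
    unfolding card_3_iff by blast
  ultimately show False using assms groetzsch_no_triangle[of i j k] by simp
qed

lemma mem_complement_edges:
  "{i, j} \<in> complement_edges E \<longleftrightarrow> i \<noteq> j \<and> {i, j} \<notin> E"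
  unfolding complement_edges_def by (auto simp: doubleton_eq_iff insert_commute[of j i])

theorem proposition4p6:
  shows "\<not> (\<exists>fs :: (11, 'k::field) mpoly list.
    zero_one_linear_sop (edge_ideal (complement_edges mycielski_groetzsch_edges)) fs)"
proof
  let ?M = mycielski_groetzsch_edges
  assume "\<exists>fs :: (11, 'k::field) mpoly list. zero_one_linear_sop (edge_ideal (complement_edges ?M)) fs"
  then obtain fs :: "(11, 'k) mpoly list"
    where sop: "linear_sop (edge_ideal (complement_edges ?M)) fs"
      and zero_one: "\<And>f m. f \<in> set fs \<Longrightarrow> Poly_Mapping.lookup f m \<in> {0, 1}"
    unfolding zero_one_linear_sop_def by blast
  have no_loop: "{v} \<notin> complement_edges E" for v :: 11 and E
    using mem_complement_edges[of v v] by simp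
  have "enat (length fs) \<le> enat 2"
    using sop krull_dim_quot_edge_ideal_le[of "complement_edges ?M" 2]
    by (simp add: linear_sop_def mem_complement_edges card_groetzsch_clique_le)
  then have len: "length fs \<le> 2" by simp
  define col where "col v = map (\<lambda>f. Poly_Mapping.lookup f (Poly_Mapping.single v 1)) fs" for v
  \<comment> \<open>The colours: nonzero 0-1 vectors with one entry per form.\<close>
  define C where "C = {xs :: 'k list. set xs \<subseteq> {0, 1} \<and> length xs = length fs} - {replicate (length fs) 0}"
  have "card C \<ge> 4"
  proof (rule groetzsch_not_3_colorable)
    show "col i \<noteq> col j" if "{i, j} \<in> ?M" for i j
    proof -
      have "i \<noteq> j" using that groetzsch_no_triangle[of i i i] by auto
      moreover have "{i, j} \<notin> complement_edges ?M" using that by (simp add: mem_complement_edges)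
      ultimately show ?thesis
        using linear_sop_columns_differ[OF sop no_loop, of i j] unfolding col_def map_eq_conv by blast
    qed
    show "finite C" by (simp add: C_def finite_lists_length_eq)
    show "range col \<subseteq> C"
    proof (rule image_subsetI)
      fix v
      have "col v \<noteq> replicate (length fs) 0"
        using linear_sop_column_nonzero[OF sop no_loop]
        by (metis col_def in_set_replicate image_eqI list.set_map)
      then show "col v \<in> C" using zero_one by (auto simp: C_def col_def)
    qed
  qed
  moreover have "card C = 2 ^ length fs - 1"
    by (simp add: C_def card_Diff_singleton card_lists_length_eq numeral_2_eq_2 set_replicate_conv_if)
  \<comment> \<open>Hence \<open>card C \<le> 3\<close>, against the four colours required.\<close>
  moreover have "(2::nat) ^ length fs \<le> 2 ^ 2"
    using len by (rule power_increasing) simp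
  ultimately show False by simp
qed

end
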